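(* Let $\mathbf{k}$ be an integral domain with unity having more than two elements. Let $X$ be a quandle (if $X$ is finite, assume that $|X|$ is not invertible in $\mathbf{k}$) containing a trivial subquandle $Y$ of order more than one. Then $\mathbf{k}[X]$ has non-trivial idempotents.
   Context: A quandle is a non-empty set $X$ with a binary operation $*$ such that, for each $y\in X$, the map $S_y:X\to X$, $S_y(x)=x*y$, is an automorphism of $(X,* )$ and $S_y(y)=y$. A quandle $Y$ is trivial if $x*y=x$ for all $x,y\in Y$. The quandle ring $\mathbf{k}[X]$ is the free $\mathbf{k}$-module with basis $\{e_x\mid x\in X\}$ with the (in general non-associative) $\mathbf{k}$-bilinear product determined by $e_xe_y=e_{x*y}$. An idempotent of $\mathbf{k}[X]$ is a non-zero $u$ with $u^2=u$; it is non-trivial if it is not of the form $e_x$ with $x\in X$. *)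

theory Defs
  imports "HOL-Library.Poly_Mapping"
begin

(* The underlying set X is an explicit carrier, so that a subquandle is a subset with the same
   operation; the values of op outside X are irrelevant. The map x \<mapsto> op x y is the
   right translation S_y. *)
definition quandle :: "'a set \<Rightarrow> ('a \<Rightarrow> 'a \<Rightarrow> 'a) \<Rightarrow> bool" where
  "quandle X op \<longleftrightarrow> X \<noteq> {} \<and>
     (\<forall>y\<in>X. bij_betw (\<lambda>x. op x y) X X \<and>
             (\<forall>a\<in>X. \<forall>b\<in>X. op (op a b) y = op (op a y) (op b y)) \<and>
             op y y = y)"

definition trivial_quandle :: "'a set \<Rightarrow> ('a \<Rightarrow> 'a \<Rightarrow> 'a) \<Rightarrow> bool" where
  "trivial_quandle Y op \<longleftrightarrow> quandle Y op \<and> (\<forall>x\<in>Y. \<forall>y\<in>Y. op x y = x)"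

definition subquandle :: "'a set \<Rightarrow> 'a set \<Rightarrow> ('a \<Rightarrow> 'a \<Rightarrow> 'a) \<Rightarrow> bool" where
  "subquandle Y X op \<longleftrightarrow> Y \<subseteq> X \<and> quandle Y op"

(* The set of elements of the quandle ring: the finitely supported functions with support in X. *)
definition quandle_ring :: "'a set \<Rightarrow> ('a \<Rightarrow>\<^sub>0 'k::idom) set" where
  "quandle_ring X = {u. Poly_Mapping.keys u \<subseteq> X}"

definition qbasis :: "'a \<Rightarrow> 'a \<Rightarrow>\<^sub>0 'k::idom" where
  "qbasis x = Poly_Mapping.single x 1"

(* The bilinear extension of e_x e_y = e_(x * y). The library product on poly_mapping is not
   usable: it takes the type class addition of the index type as the operation. *)
definition qmult ::
  "('a \<Rightarrow> 'a \<Rightarrow> 'a) \<Rightarrow> ('a \<Rightarrow>\<^sub>0 'k) \<Rightarrow> ('a \<Rightarrow>\<^sub>0 'k) \<Rightarrow> 'a \<Rightarrow>\<^sub>0 'k::idom" where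
  "qmult op u v =
     (\<Sum>x\<in>Poly_Mapping.keys u. \<Sum>y\<in>Poly_Mapping.keys v.
        Poly_Mapping.single (op x y) (Poly_Mapping.lookup u x * Poly_Mapping.lookup v y))"

definition idempotent_in ::
  "'a set \<Rightarrow> ('a \<Rightarrow> 'a \<Rightarrow> 'a) \<Rightarrow> ('a \<Rightarrow>\<^sub>0 'k::idom) \<Rightarrow> bool" where
  "idempotent_in X op u \<longleftrightarrow> u \<in> quandle_ring X \<and> u \<noteq> 0 \<and> qmult op u u = u"

definition nontrivial_idempotent_in ::
  "'a set \<Rightarrow> ('a \<Rightarrow> 'a \<Rightarrow> 'a) \<Rightarrow> ('a \<Rightarrow>\<^sub>0 'k::idom) \<Rightarrow> bool" where
  "nontrivial_idempotent_in X op u \<longleftrightarrow> idempotent_in X op u \<and> (\<forall>x\<in>X. u \<noteq> qbasis x)"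

lemma qmult_superset:
  assumes "finite A" "finite B" "Poly_Mapping.keys u \<subseteq> A" "Poly_Mapping.keys v \<subseteq> B"
  shows "qmult op u v = (\<Sum>x\<in>A. \<Sum>y\<in>B.
    Poly_Mapping.single (op x y) (Poly_Mapping.lookup u x * Poly_Mapping.lookup v y))"
proof -
  have "qmult op u v = (\<Sum>x\<in>A. \<Sum>y\<in>Poly_Mapping.keys v.
    Poly_Mapping.single (op x y) (Poly_Mapping.lookup u x * Poly_Mapping.lookup v y))"
    unfolding qmult_def using assms
    by (intro sum.mono_neutral_left) (auto simp: in_keys_iff)
  also have "\<dots> = (\<Sum>x\<in>A. \<Sum>y\<in>B.
    Poly_Mapping.single (op x y) (Poly_Mapping.lookup u x * Poly_Mapping.lookup v y))"
    using assms by (intro sum.cong sum.mono_neutral_left) (auto simp: in_keys_iff)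
  finally show ?thesis .
qed

lemma qmult_single:
  "qmult op (Poly_Mapping.single x a) (Poly_Mapping.single y b) =
     Poly_Mapping.single (op x y) (a * b)"
  by (subst qmult_superset[of "{x}" "{y}"]) auto

lemma qmult_qbasis: "qmult op (qbasis x) (qbasis y) = (qbasis (op x y) :: 'a \<Rightarrow>\<^sub>0 'k::idom)"
  by (simp add: qbasis_def qmult_single)

lemma qmult_add_left: "qmult op (u + v) w = qmult op u w + qmult op v w"
  using Poly_Mapping.keys_add[of u v]
  by (simp add: qmult_superset[of "Poly_Mapping.keys u \<union> Poly_Mapping.keys v" "Poly_Mapping.keys w"]
      lookup_add distrib_right Poly_Mapping.single_add sum.distrib)

lemma qmult_add_right: "qmult op w (u + v) = qmult op w u + qmult op w v"
  using Poly_Mapping.keys_add[of u v]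
  by (simp add: qmult_superset[of "Poly_Mapping.keys w" "Poly_Mapping.keys u \<union> Poly_Mapping.keys v"]
      lookup_add distrib_left Poly_Mapping.single_add sum.distrib)

lemma qmult_closed:
  assumes "quandle X op" "u \<in> quandle_ring X" "v \<in> quandle_ring X"
  shows "qmult op u v \<in> quandle_ring X"
proof -
  have "op x y \<in> X" if "x \<in> X" "y \<in> X" for x y
    using assms(1) that unfolding quandle_def bij_betw_def by blast
  then show ?thesis
    using assms(2,3) unfolding quandle_ring_def qmult_def
    by (fastforce dest!: subsetD[OF Poly_Mapping.keys_sum] split: if_splits)
qed

end

(* If y and z are distinct elements of a trivial subquandle, then e_y e_z = e_y and
   e_z e_y = e_z, so an element u supported on {y, z} satisfies u^2 = s u with s the sum of its
   coefficients. Hence (1 - a) e_y + a e_z is idempotent for every scalar a, and it is not a basis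
   element as soon as a is neither 0 nor 1. *)
theory Submission
  imports Defs
begin

lemma exists_not_zero_one:
  assumes "infinite (UNIV :: 'k::zero_neq_one set) \<or> card (UNIV :: 'k::zero_neq_one set) > 2"
  obtains a :: "'k::zero_neq_one" where "a \<noteq> 0" "a \<noteq> 1"
proof -
  have "UNIV \<noteq> {0, 1 :: 'k}"
  proof
    assume *: "UNIV = {0, 1 :: 'k}"
    show False
      \<comment> \<open>With 0 and 1 as the only scalars, the type would be finite with exactly 2
        elements, against both alternatives of the assumption.\<close>
      using assms unfolding * by simp
  qed
  then show thesis
    using that by blast
qed

lemma exists_two_distinct:
  assumes "infinite Y \<or> card Y > 1"
  obtains y z where "y \<in> Y" "z \<in> Y" "y \<noteq> z"
proof -
  have "\<not> is_singleton Y" "Y \<noteq> {}"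
    using assms by (auto simp: is_singleton_def)
  then show thesis
    using that by (metis all_not_in_conv is_singletonI')
qed

lemma qmult_self_two_trivial:
  fixes a b :: "'k::idom"
  assumes "op y y = y" "op y z = y" "op z y = z" "op z z = z"
    and "a + b = 1"
  defines "u \<equiv> Poly_Mapping.single y a + Poly_Mapping.single z b"
  shows "qmult op u u = u"
proof -
  \<comment> \<open>In each of the four products of basis elements the left factor survives, so both
    coefficients pick up the factor \<open>a + b\<close>.\<close>
  have "qmult op u u = Poly_Mapping.single y (a * (a + b)) + Poly_Mapping.single z (b * (a + b))"
    by (simp add: u_def qmult_add_left qmult_add_right qmult_single assms(1-4)
        distrib_left Poly_Mapping.single_add ac_simps)
  then show ?thesis
    by (simp add: u_def assms(5))
qed

text \<open>The coefficients at \<open>y\<close> and at \<open>z\<close> are both non-zero on the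
  left, while the right side is supported on at most one point.\<close>

lemma two_point_neq_single:
  assumes "y \<noteq> z" "a \<noteq> 0" "b \<noteq> 0"
  shows "Poly_Mapping.single y a + Poly_Mapping.single z b \<noteq> Poly_Mapping.single x c"
proof
  assume eq: "Poly_Mapping.single y a + Poly_Mapping.single z b = Poly_Mapping.single x c"
  have "x = y" "x = z"
    using arg_cong[OF eq, of "\<lambda>u. Poly_Mapping.lookup u y"]
      arg_cong[OF eq, of "\<lambda>u. Poly_Mapping.lookup u z"] assms
    by (auto simp: lookup_add lookup_single when_def split: if_splits)
  with \<open>y \<noteq> z\<close> show False by simp
qed

theorem proposition3p3:
  fixes X Y :: "'a set" and op :: "'a \<Rightarrow> 'a \<Rightarrow> 'a"
  assumes more_than_two: "infinite (UNIV :: 'k::idom set) \<or> card (UNIV :: 'k set) > 2"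
    and X: "quandle X op"
    and card_X: "finite X \<Longrightarrow> \<not> (of_nat (card X) :: 'k) dvd 1"
    and Y: "subquandle Y X op" "trivial_quandle Y op"
    and order_Y: "infinite Y \<or> card Y > 1"
  shows "\<exists>u :: 'a \<Rightarrow>\<^sub>0 'k. nontrivial_idempotent_in X op u"
proof -
  obtain a :: 'k where a: "a \<noteq> 0" "a \<noteq> 1"
    using exists_not_zero_one[OF more_than_two] .
  obtain y z where yz: "y \<in> Y" "z \<in> Y" "y \<noteq> z"
    using exists_two_distinct[OF order_Y] .
  define u where "u = Poly_Mapping.single y (1 - a) + Poly_Mapping.single z a"
  \<comment> \<open>The scalar \<open>c\<close> stays arbitrary to serve twice: \<open>c = 0\<close>
    shows that \<open>u\<close> is non-zero, and \<open>c = 1\<close> separates it from every basis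
    element.\<close>
  have neq: "u \<noteq> Poly_Mapping.single x c" for x c
    unfolding u_def using a yz by (intro two_point_neq_single) auto
  have "Poly_Mapping.keys u \<subseteq> {y, z}"
    unfolding u_def by (rule order_trans[OF Poly_Mapping.keys_add]) auto
  then have "u \<in> quandle_ring X"
    using Y(1) yz by (auto simp: quandle_ring_def subquandle_def)
  moreover have "u \<noteq> 0"
    using neq[of y 0] by simp
  moreover have "qmult op u u = u"
    unfolding u_def using Y(2) yz
    by (intro qmult_self_two_trivial) (auto simp: trivial_quandle_def)
  ultimately show ?thesis
    using neq unfolding nontrivial_idempotent_in_def idempotent_in_def qbasis_def by blast
qed

end
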